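(* Let $\mathcal{E}=(\mathcal{X},\mathcal{B},\mathcal{P}=\{\mathrm{P}_{\theta}\mid\theta\in\Theta\})$ be a statistical experiment with privileged dominating probability measure $\mathrm{P}_{0}$, let $\mathcal{B}_0\subseteq\mathcal{B}$ be a sub-$\sigma$-field, and let $(\mathcal{F}_k)_{k\in\mathbb{N}}$ be a convergent filtration in $\mathcal{B}_0$ satisfying $\mathcal{S}_{\mathcal{F}_k}\subseteq\mathcal{S}_{\mathcal{B}_0}$ for all $k\in\mathbb{N}$. Then $\mathcal{E}_{\mathcal{B}_0}$ is boundedly complete in $\mathcal{E}$ if and only if, for every $k\in\mathbb{N}$, the restricted subexperiment $\mathcal{E}_{\mathcal{F}_k}$ is boundedly complete in $\mathcal{E}$.
   Context: A statistical experiment $\mathcal{E}=(\mathcal{X},\mathcal{B},\mathcal{P})$ consists of a measurable space $(\mathcal{X},\mathcal{B})$ and a family $\mathcal{P}=\{\mathrm{P}_{\theta}\mid\theta\in\Theta\}$ of probability measures on it, indexed by a parameter $\theta$ in an arbitrary (possibly infinite-dimensional) parameter space $\Theta$. A privileged dominating measure is a probability measure $\mathrm{P}_{0}$ on $(\mathcal{X},\mathcal{B})$ (which may or may not belong to $\mathcal{P}$) such that all $\mathrm{P}_{\theta}$ are absolutely continuous with respect to $\mathrm{P}_{0}$ and, for every $B\in\mathcal{B}$, $\mathrm{P}_{0}(B)=0$ if and only if $\mathrm{P}_{\theta}(B)=0$ for all $\theta\in\Theta$. It is assumed throughout that such a $\mathrm{P}_{0}$ is given. $\mathrm{E}_{0}$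 and $\mathrm{E}_{\theta}$ denote expectation under $\mathrm{P}_{0}$ and $\mathrm{P}_{\theta}$, and $d\mathrm{P}_{\theta}/d\mathrm{P}_{0}$ is the Radon-Nikodym derivative. For a sub-$\sigma$-field $\mathcal{A}\subseteq\mathcal{B}$, the restricted subexperiment is $\mathcal{E}_{\mathcal{A}}=(\mathcal{X},\mathcal{A},\mathcal{P})$, and $$\mathcal{S}_{\mathcal{A}}=\mathrm{span}\left(\left\{\mathrm{E}_{0}\left[\frac{d\mathrm{P}_{\theta}}{d\mathrm{P}_{0}}\,\Big|\,\mathcal{A}\right]:\theta\in\Theta\right\}\right),$$ where $\mathrm{span}$ denotes the set of all (finite, real) linear combinations; random variables are identified when $\mathrm{P}_{0}$-a.s. equal. A random variable $Y$ is (essentially) bounded if there is a constant $0\le M<\infty$ with $\mathrm{P}_{\theta}(|Y|\le M)=1$ for all $\theta\in\Theta$. The $\sigma$-field $\mathcal{A}$ (equivalently, $\mathcal{E}_{\mathcal{A}}$) is boundedly complete in $\mathcal{E}$ if every $\mathcal{A}$-measurable (essentially) bounded real random variable $Y$ such that $\mathrm{E}_{\theta}(Y)=0$ for all $\theta\in\Theta$ is $\mathrm{P}_{\theta}$-a.s. equal to zero for all $\theta\in\Theta$ (equivalently, $\mathrm{P}_{0}$-a.s. equal to zero). A sequence $(\mathcal{F}_k)_{k\in\mathbb{N}}$ of $\sigma$-fields is a convergent filtration in $\mathcal{B}_0$ if $\mathcal{F}_k\subseteq\mathcal{F}_{k+1}\subseteq\mathcal{B}_0$ for each $k\in\mathbb{N}$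 and the $\sigma$-field generated by $\bigcup_{k\in\mathbb{N}}\mathcal{F}_k$ equals $\mathcal{B}_0$. *)

theory Defs
  imports "HOL-Probability.Probability"
begin

text \<open>
  Sigma-fields are represented by values of type \<^typ>\<open>'a measure\<close>, of which only \<^const>\<open>space\<close>
  and \<^const>\<open>sets\<close> matter (\<^const>\<open>subalgebra\<close> is insensitive to the measures carried by its
  arguments). In particular \<open>B\<close> below stands for the measurable space of the experiment.
\<close>

locale statistical_experiment =
  fixes B :: "'a measure" and \<Theta> :: "'t set" and P :: "'t \<Rightarrow> 'a measure"
  assumes prob_space_P: "\<theta> \<in> \<Theta> \<Longrightarrow> prob_space (P \<theta>)"
    and sets_P: "\<theta> \<in> \<Theta> \<Longrightarrow> sets (P \<theta>) = sets B"

locale privileged_experiment = statistical_experiment B \<Theta> P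
  for B :: "'a measure" and \<Theta> :: "'t set" and P :: "'t \<Rightarrow> 'a measure" +
  fixes P0 :: "'a measure"
  assumes prob_space_P0: "prob_space P0"
    and sets_P0: "sets P0 = sets B"
    and absolutely_continuous_P: "\<theta> \<in> \<Theta> \<Longrightarrow> absolutely_continuous P0 (P \<theta>)"
    and null_P0_iff: "A \<in> sets B \<Longrightarrow> emeasure P0 A = 0 \<longleftrightarrow> (\<forall>\<theta>\<in>\<Theta>. emeasure (P \<theta>) A = 0)"

text \<open>
  The linear span of the conditional expectations \<open>E\<^sub>0[dP\<^sub>\<theta>/dP\<^sub>0 | A]\<close>. Random variables are
  identified when almost surely equal under \<open>P0\<close>, so the set of functions is saturated under
  this equivalence; inclusions between such sets are inclusions of the sets of classes.
\<close>

definition cond_density_span ::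
    "'t set \<Rightarrow> ('t \<Rightarrow> 'a measure) \<Rightarrow> 'a measure \<Rightarrow> 'a measure \<Rightarrow> ('a \<Rightarrow> real) set" where
  "cond_density_span \<Theta> P P0 A =
    {f \<in> borel_measurable P0. \<exists>T c. finite T \<and> T \<subseteq> \<Theta> \<and>
       (AE x in P0. f x =
          (\<Sum>\<theta>\<in>T. c \<theta> * real_cond_exp P0 A (\<lambda>y. enn2real (RN_deriv P0 (P \<theta>) y)) x))}"

definition essentially_bounded ::
    "'t set \<Rightarrow> ('t \<Rightarrow> 'a measure) \<Rightarrow> ('a \<Rightarrow> real) \<Rightarrow> bool" where
  "essentially_bounded \<Theta> P Y \<longleftrightarrow> (\<exists>M\<ge>0. \<forall>\<theta>\<in>\<Theta>. AE x in P \<theta>. \<bar>Y x\<bar> \<le> M)"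

definition boundedly_complete ::
    "'t set \<Rightarrow> ('t \<Rightarrow> 'a measure) \<Rightarrow> 'a measure \<Rightarrow> bool" where
  "boundedly_complete \<Theta> P A \<longleftrightarrow>
    (\<forall>Y \<in> borel_measurable A. essentially_bounded \<Theta> P Y \<longrightarrow>
       (\<forall>\<theta>\<in>\<Theta>. integral\<^sup>L (P \<theta>) Y = 0) \<longrightarrow> (\<forall>\<theta>\<in>\<Theta>. AE x in P \<theta>. Y x = 0))"

definition convergent_filtration :: "'a measure \<Rightarrow> (nat \<Rightarrow> 'a measure) \<Rightarrow> bool" where
  "convergent_filtration B0 F \<longleftrightarrow>
    (\<forall>k. subalgebra (F (Suc k)) (F k) \<and> subalgebra B0 (F k)) \<and>
    sigma_sets (space B0) (\<Union>k. sets (F k)) = sets B0"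

end

theory Submission
  imports Defs
begin

text \<open>
  Bounded completeness passes to smaller \<open>\<sigma>\<close>-fields. Conversely, let \<open>Y\<close> be bounded,
  \<open>B0\<close>-measurable and unbiased for zero; this means that \<open>Y\<close> is orthogonal in \<open>P0\<close> to the
  conditional density span of \<open>B0\<close>, hence to that of \<open>F k\<close>. As conditional expectation is
  self-adjoint, \<open>E\<^sub>0[Y | F k]\<close> is then also unbiased for zero, so it vanishes by completeness of
  \<open>F k\<close>. Thus \<open>Y\<close> integrates to zero over each set of the \<open>\<pi>\<close>-system \<open>\<Union>k. sets (F k)\<close>, so over
  each set of \<open>B0\<close>.
\<close>

text \<open>Dynkin's argument: the sets over which \<open>f\<close> integrates to zero are closed
  under complements, because the whole space lies in \<open>G\<close>, and under countable disjoint
  unions, because the integral is countably additive.\<close>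

lemma set_integral_eq_zero_sigma_sets:
  fixes f :: "'a \<Rightarrow> 'b::{banach, second_countable_topology}"
  assumes f: "integrable M f"
    and G: "Int_stable G" "G \<subseteq> sets M" "space M \<in> G"
    and zero: "\<And>A. A \<in> G \<Longrightarrow> (LINT x:A|M. f x) = 0"
    and A: "A \<in> sigma_sets (space M) G"
  shows "(LINT x:A|M. f x) = 0"
proof -
  have sub: "S \<in> sets M" if "S \<in> sigma_sets (space M) G" for S
    using that G(2) sets.sigma_sets_subset by blast
  have int: "set_integrable M S f" if "S \<in> sets M" for S
    unfolding set_integrable_def by (rule integrable_mult_indicator[OF that f])
  have "G \<subseteq> Pow (space M)"
    using G(2) sets.space_closed by blast
  with G(1) show ?thesis using A
  proof (induction rule: sigma_sets_induct_disjoint)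
    case (basic S)
    then show ?case by (rule zero)
  next
    case empty
    show ?case by (simp add: set_lebesgue_integral_def)
  next
    case (compl S)
    then have S: "S \<in> sets M" by (intro sub)
    then have "(LINT x:(space M - S) \<union> S|M. f x) = (LINT x:space M - S|M. f x) + (LINT x:S|M. f x)"
      by (intro set_integral_Un int) auto
    moreover have "(space M - S) \<union> S = space M"
      using sets.sets_into_space[OF S] by auto
    ultimately show ?case using compl zero[OF G(3)] by simp
  next
    case (union S)
    then have S: "S i \<in> sets M" for i using sub by auto
    have "(LINT x:(\<Union>i. S i)|M. f x) = (\<Sum>i. (LINT x:S i|M. f x))"
      using union(1) S by (intro lebesgue_integral_countable_add int) (auto simp: disjoint_family_on_def)
    then show ?case using union by simp
  qed
qed

text \<open>Both \<open>f\<close> and the zero function are versions of the conditional expectation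
  of \<open>f\<close> given \<open>F\<close>, so they agree almost surely.\<close>

lemma (in finite_measure) AE_eq_zero_if_set_integral_zero:
  assumes "subalgebra M F" "integrable M f" "f \<in> borel_measurable F"
    and "\<And>A. A \<in> sets F \<Longrightarrow> (LINT x:A|M. f x) = (0::real)"
  shows "AE x in M. f x = 0"
proof -
  interpret finite_measure_subalgebra M F
    by unfold_locales (rule assms)
  have "AE x in M. real_cond_exp M F f x = 0"
    by (rule real_cond_exp_charact) (use assms in auto)
  moreover have "AE x in M. real_cond_exp M F f x = f x"
    by (rule real_cond_exp_F_meas) (use assms in auto)
  ultimately show ?thesis by eventually_elim simp
qed

text \<open>Self-adjointness: both sides equal the integral of the product of the two conditional
  expectations, since on each side one factor is already \<open>F\<close>-measurable.\<close>

lemma (in sigma_finite_subalgebra) integral_mult_real_cond_exp_swap: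
  assumes "integrable M (\<lambda>x. real_cond_exp M F f x * g x)"
    and "integrable M (\<lambda>x. f x * real_cond_exp M F g x)"
    and "f \<in> borel_measurable M" "g \<in> borel_measurable M"
  shows "(\<integral>x. real_cond_exp M F f x * g x \<partial>M) = (\<integral>x. f x * real_cond_exp M F g x \<partial>M)"
  using real_cond_exp_intg(2)[of "real_cond_exp M F f" g]
    real_cond_exp_intg(2)[of "real_cond_exp M F g" f] assms
  by (simp add: mult.commute)

text \<open>Conditional expectation respects each of the bounds \<open>- c\<close> and
  \<open>c\<close>. This keeps the projection of a bounded \<open>Y\<close> among the variables that
  bounded completeness tests.\<close>

lemma (in sigma_finite_subalgebra) AE_abs_real_cond_exp_le:
  assumes "integrable M f" "AE x in M. \<bar>f x\<bar> \<le> c"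
  shows "AE x in M. \<bar>real_cond_exp M F f x\<bar> \<le> c"
proof -
  have "AE x in M. - c \<le> real_cond_exp M F f x"
    using assms by (intro real_cond_exp_ge_c) auto
  moreover have "AE x in M. real_cond_exp M F f x \<le> c"
    using assms by (intro real_cond_exp_le_c) auto
  ultimately show ?thesis by eventually_elim auto
qed

lemma integrable_mult_AE_bounded:
  fixes f g :: "'a \<Rightarrow> real"
  assumes "integrable M g" "f \<in> borel_measurable M" "AE x in M. \<bar>f x\<bar> \<le> c"
  shows "integrable M (\<lambda>x. f x * g x)"
proof (rule Bochner_Integration.integrable_bound)
  show "integrable M (\<lambda>x. c * g x)" using assms by simp
  show "AE x in M. norm (f x * g x) \<le> norm (c * g x)"
    using assms(3) by eventually_elim (auto simp: abs_mult intro!: mult_right_mono)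
qed (use assms in measurable)

lemma boundedly_complete_subalgebra:
  assumes "subalgebra A A'" "boundedly_complete \<Theta> P A"
  shows "boundedly_complete \<Theta> P A'"
  using assms(2) measurable_from_subalg[OF assms(1)] unfolding boundedly_complete_def by blast

context privileged_experiment
begin

interpretation P0: prob_space P0 by (rule prob_space_P0)

abbreviation dens :: "'t \<Rightarrow> 'a \<Rightarrow> real" where
  "dens \<theta> \<equiv> \<lambda>x. enn2real (RN_deriv P0 (P \<theta>) x)"

lemma sets_P_eq_P0: "\<theta> \<in> \<Theta> \<Longrightarrow> sets (P \<theta>) = sets P0"
  using sets_P sets_P0 by simp

lemma AE_P_if_AE_P0:
  "\<theta> \<in> \<Theta> \<Longrightarrow> AE x in P0. Q x \<Longrightarrow> AE x in P \<theta>. Q x"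
  using absolutely_continuous_AE[OF sets_P_eq_P0 absolutely_continuous_P] .

text \<open>Here the privileged property of \<open>P0\<close> enters: the exceptional set is an
  event that is null under every \<open>P \<theta>\<close>, hence null under
  \<open>P0\<close>.\<close>

lemma AE_P0_if_AE_P:
  assumes "Measurable.pred P0 Q" "\<And>\<theta>. \<theta> \<in> \<Theta> \<Longrightarrow> AE x in P \<theta>. Q x"
  shows "AE x in P0. Q x"
proof -
  define N where "N = {x \<in> space P0. \<not> Q x}"
  have N: "N \<in> sets P0" unfolding N_def using assms(1) by measurable
  have "emeasure (P \<theta>) N = 0" if \<theta>: "\<theta> \<in> \<Theta>" for \<theta>
  proof -
    have sp: "space (P \<theta>) = space P0" by (rule sets_eq_imp_space_eq[OF sets_P_eq_P0[OF \<theta>]])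
    show ?thesis using AE_iff_measurable[of N "P \<theta>" Q] assms(2)[OF \<theta>] N sets_P_eq_P0[OF \<theta>]
      unfolding sp N_def by simp
  qed
  then have "emeasure P0 N = 0" using null_P0_iff N sets_P0 by simp
  then show ?thesis using AE_iff_measurable[OF N] N_def by simp
qed

lemma integral_P:
  assumes "\<theta> \<in> \<Theta>" "f \<in> borel_measurable P0"
  shows "integral\<^sup>L (P \<theta>) f = (\<integral>x. f x * dens \<theta> x \<partial>P0)"
proof -
  interpret P: prob_space "P \<theta>" using assms prob_space_P by simp
  show ?thesis
    using P0.RN_deriv_integral[OF P.sigma_finite_measure_axioms absolutely_continuous_P sets_P_eq_P0]
      assms by (simp add: mult.commute)
qed

lemma integrable_dens:
  assumes "\<theta> \<in> \<Theta>"
  shows "integrable P0 (dens \<theta>)"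
proof -
  interpret P: prob_space "P \<theta>" using assms prob_space_P by simp
  \<comment> \<open>The constant \<open>1\<close> is integrable under the probability measure
    \<open>P \<theta>\<close>; changing measure turns this into integrability of the
    density.\<close>
  show ?thesis
    using P0.RN_deriv_integrable[OF P.sigma_finite_measure_axioms absolutely_continuous_P sets_P_eq_P0,
        of "\<lambda>_. 1"] assms by simp
qed

lemma integral_mult_cond_density_span_eq_zero:
  assumes sub: "subalgebra B A" and Y: "Y \<in> borel_measurable A"
    and bdd: "AE x in P0. \<bar>Y x\<bar> \<le> c"
    and zero: "\<And>\<theta>. \<theta> \<in> \<Theta> \<Longrightarrow> integral\<^sup>L (P \<theta>) Y = 0"
    and h: "h \<in> cond_density_span \<Theta> P P0 A"
  shows "(\<integral>x. Y x * h x \<partial>P0) = 0"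
proof -
  have sub0: "subalgebra P0 A"
    using sub sets_P0 sets_eq_imp_space_eq[OF sets_P0] by (simp add: subalgebra_def)
  interpret A: finite_measure_subalgebra P0 A
    by unfold_locales (rule sub0)
  have Y0 [measurable]: "Y \<in> borel_measurable P0"
    by (rule measurable_from_subalg[OF sub0 Y])
  let ?e = "\<lambda>\<theta>. real_cond_exp P0 A (dens \<theta>)"
  obtain T a where T: "finite T" "T \<subseteq> \<Theta>" and [measurable]: "h \<in> borel_measurable P0"
    and h_eq: "AE x in P0. h x = (\<Sum>\<theta>\<in>T. a \<theta> * ?e \<theta> x)"
    using h unfolding cond_density_span_def by blast
  have Ye: "integrable P0 (\<lambda>x. Y x * ?e \<theta> x)" "(\<integral>x. Y x * ?e \<theta> x \<partial>P0) = 0" if \<theta>: "\<theta> \<in> \<Theta>" for \<theta>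
  proof -
    have int: "integrable P0 (\<lambda>x. Y x * dens \<theta> x)"
      by (rule integrable_mult_AE_bounded[OF integrable_dens[OF \<theta>] Y0 bdd])
    show "integrable P0 (\<lambda>x. Y x * ?e \<theta> x)"
      by (rule A.real_cond_exp_intg(1)[OF int Y]) simp
    have "(\<integral>x. Y x * ?e \<theta> x \<partial>P0) = (\<integral>x. Y x * dens \<theta> x \<partial>P0)"
      by (rule A.real_cond_exp_intg(2)[OF int Y]) simp
    then show "(\<integral>x. Y x * ?e \<theta> x \<partial>P0) = 0"
      using integral_P[OF \<theta> Y0] zero[OF \<theta>] by simp
  qed
  have "(\<integral>x. Y x * h x \<partial>P0) = (\<integral>x. (\<Sum>\<theta>\<in>T. a \<theta> * (Y x * ?e \<theta> x)) \<partial>P0)"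
    by (rule integral_cong_AE)
       (use h_eq in \<open>auto simp: sum_distrib_left mult.left_commute\<close>)
  also have "\<dots> = (\<Sum>\<theta>\<in>T. a \<theta> * (\<integral>x. Y x * ?e \<theta> x \<partial>P0))"
    using T(2) by (subst Bochner_Integration.integral_sum) (auto intro!: Ye(1))
  also have "\<dots> = 0" using T(2) by (intro sum.neutral) (auto simp: Ye(2))
  finally show ?thesis .
qed

lemma real_cond_exp_dens_in_span:
  assumes "\<theta> \<in> \<Theta>"
  shows "real_cond_exp P0 A (dens \<theta>) \<in> cond_density_span \<Theta> P P0 A"
  unfolding cond_density_span_def
  using assms by (auto intro!: exI[of _ "{\<theta>}"] exI[of _ "\<lambda>_. 1"])

text \<open>The core of the converse, applied with \<open>A\<close> as \<open>B0\<close> and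
  \<open>A'\<close> as \<open>F k\<close>. The span inclusion makes the projection of
  \<open>Y\<close> onto \<open>A'\<close> unbiased for zero, so completeness of \<open>A'\<close>
  applies to it.\<close>

lemma real_cond_exp_eq_zero_if_boundedly_complete:
  assumes sub: "subalgebra B A" "subalgebra B A'" and Y: "Y \<in> borel_measurable A"
    and bdd: "AE x in P0. \<bar>Y x\<bar> \<le> c" "c \<ge> 0"
    and zero: "\<And>\<theta>. \<theta> \<in> \<Theta> \<Longrightarrow> integral\<^sup>L (P \<theta>) Y = 0"
    and span: "cond_density_span \<Theta> P P0 A' \<subseteq> cond_density_span \<Theta> P P0 A"
    and compl: "boundedly_complete \<Theta> P A'"
  shows "AE x in P0. real_cond_exp P0 A' Y x = 0"
proof -
  have sub0: "subalgebra P0 A" "subalgebra P0 A'"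
    using sub sets_P0 sets_eq_imp_space_eq[OF sets_P0] by (simp_all add: subalgebra_def)
  interpret A': finite_measure_subalgebra P0 A'
    by unfold_locales (rule sub0)
  have Y0 [measurable]: "Y \<in> borel_measurable P0"
    by (rule measurable_from_subalg[OF sub0(1) Y])
  have intY: "integrable P0 Y"
    by (rule P0.integrable_const_bound[of _ c]) (use bdd in auto)
  let ?Z = "real_cond_exp P0 A' Y"
  have bddZ: "AE x in P0. \<bar>?Z x\<bar> \<le> c"
    by (rule A'.AE_abs_real_cond_exp_le[OF intY bdd(1)])
  have "integral\<^sup>L (P \<theta>) ?Z = 0" if \<theta>: "\<theta> \<in> \<Theta>" for \<theta>
  proof -
    have "integral\<^sup>L (P \<theta>) ?Z = (\<integral>x. ?Z x * dens \<theta> x \<partial>P0)"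
      by (rule integral_P[OF \<theta>]) simp
    also have "\<dots> = (\<integral>x. Y x * real_cond_exp P0 A' (dens \<theta>) x \<partial>P0)"
      using integrable_mult_AE_bounded[OF integrable_dens[OF \<theta>] _ bddZ]
        integrable_mult_AE_bounded[OF A'.real_cond_exp_int(1)[OF integrable_dens[OF \<theta>]] Y0 bdd(1)]
      by (intro A'.integral_mult_real_cond_exp_swap) auto
    also have "\<dots> = 0"
      \<comment> \<open>The density conditioned on \<open>A'\<close> belongs to the span for
        \<open>A\<close> by the inclusion, and \<open>Y\<close> is orthogonal to that span.\<close>
      using real_cond_exp_dens_in_span[OF \<theta>] span
      by (intro integral_mult_cond_density_span_eq_zero[OF sub(1) Y bdd(1) zero]) auto
    finally show ?thesis .
  qed
  moreover have "essentially_bounded \<Theta> P ?Z"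
    unfolding essentially_bounded_def using bdd(2) AE_P_if_AE_P0[OF _ bddZ] by blast
  ultimately have "\<forall>\<theta>\<in>\<Theta>. AE x in P \<theta>. ?Z x = 0"
    using compl unfolding boundedly_complete_def by simp
  then show ?thesis by (intro AE_P0_if_AE_P) auto
qed

end

theorem proposition2:
  fixes B B0 P0 :: "'a measure" and \<Theta> :: "'t set" and P :: "'t \<Rightarrow> 'a measure"
    and F :: "nat \<Rightarrow> 'a measure"
  assumes "privileged_experiment B \<Theta> P P0"
    and "subalgebra B B0"
    and "convergent_filtration B0 F"
    and "\<And>k. cond_density_span \<Theta> P P0 (F k) \<subseteq> cond_density_span \<Theta> P P0 B0"
  shows "boundedly_complete \<Theta> P B0 \<longleftrightarrow> (\<forall>k. boundedly_complete \<Theta> P (F k))"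
proof -
  interpret privileged_experiment B \<Theta> P P0 by fact
  interpret P0: prob_space P0 by (rule prob_space_P0)
  have F_Suc: "subalgebra (F (Suc k)) (F k)" and F_B0: "subalgebra B0 (F k)" for k
    using assms(3) by (auto simp: convergent_filtration_def)
  have gen: "sigma_sets (space B0) (\<Union>k. sets (F k)) = sets B0"
    using assms(3) by (simp add: convergent_filtration_def)
  have P0_B0: "subalgebra P0 B0"
    using assms(2) sets_P0 sets_eq_imp_space_eq[OF sets_P0] by (simp add: subalgebra_def)
  have P0_F: "subalgebra P0 (F k)" and B_F: "subalgebra B (F k)" for k
    using P0_B0 assms(2) F_B0[of k] by (auto simp: subalgebra_def)
  have "mono (\<lambda>k. sets (F k))"
    using F_Suc by (intro incseq_SucI) (auto simp: subalgebra_def)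
  \<comment> \<open>Sets from levels \<open>i\<close> and \<open>j\<close> both lie in level
    \<open>max i j\<close>, which is closed under intersection.\<close>
  then have stable: "Int_stable (\<Union>k. sets (F k))"
  proof (intro Int_stableI, elim UN_E)
    fix a b i j assume "mono (\<lambda>k. sets (F k))" "a \<in> sets (F i)" "b \<in> sets (F j)"
    then have "a \<in> sets (F (max i j))" "b \<in> sets (F (max i j))"
      by (meson max.cobounded1 max.cobounded2 monoD subsetD)+
    then show "a \<inter> b \<in> (\<Union>k. sets (F k))" by blast
  qed
  show ?thesis
  proof (intro iffI allI)
    fix k assume "boundedly_complete \<Theta> P B0"
    then show "boundedly_complete \<Theta> P (F k)" by (rule boundedly_complete_subalgebra[OF F_B0])
  next
    assume compl: "\<forall>k. boundedly_complete \<Theta> P (F k)"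
    show "boundedly_complete \<Theta> P B0"
      unfolding boundedly_complete_def
    proof (intro ballI impI)
      fix Y \<theta>
      assume Y: "Y \<in> borel_measurable B0" and "essentially_bounded \<Theta> P Y"
        and zero: "\<forall>\<theta>\<in>\<Theta>. integral\<^sup>L (P \<theta>) Y = 0" and \<theta>: "\<theta> \<in> \<Theta>"
      then obtain c where c: "c \<ge> 0" "\<And>\<theta>. \<theta> \<in> \<Theta> \<Longrightarrow> AE x in P \<theta>. \<bar>Y x\<bar> \<le> c"
        unfolding essentially_bounded_def by blast
      have Y0 [measurable]: "Y \<in> borel_measurable P0"
        by (rule measurable_from_subalg[OF P0_B0 Y])
      have bdd: "AE x in P0. \<bar>Y x\<bar> \<le> c"
        by (rule AE_P0_if_AE_P[OF _ c(2)]) measurable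
      have intY: "integrable P0 Y"
        by (rule P0.integrable_const_bound[of _ c]) (use bdd in auto)
      have "(LINT x:S|P0. Y x) = 0" if S: "S \<in> sets (F k)" for S k
      proof -
        interpret Fk: finite_measure_subalgebra P0 "F k"
          by unfold_locales (rule P0_F)
        have S0: "S \<in> sets P0" using S P0_F by (auto simp: subalgebra_def)
        have "AE x in P0. real_cond_exp P0 (F k) Y x = 0"
          by (rule real_cond_exp_eq_zero_if_boundedly_complete[OF assms(2) B_F Y bdd c(1)])
             (use zero assms(4) compl in auto)
        \<comment> \<open>Over a set of \<open>F k\<close>, the variable \<open>Y\<close> and its
          conditional expectation given \<open>F k\<close> have the same integral.\<close>
        then have "(LINT x:S|P0. real_cond_exp P0 (F k) Y x) = 0"
          unfolding set_lebesgue_integral_def by (intro integral_eq_zero_AE) auto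
        then show ?thesis using Fk.real_cond_exp_intA[OF intY S] by simp
      qed
      moreover have "space P0 \<in> (\<Union>k. sets (F k))"
        using P0_F[of 0] sets.top[of "F 0"] by (auto simp: subalgebra_def)
      moreover have "(\<Union>k. sets (F k)) \<subseteq> sets P0"
        using P0_F by (auto simp: subalgebra_def)
      moreover have "sigma_sets (space P0) (\<Union>k. sets (F k)) = sets B0"
        using gen P0_B0 by (simp add: subalgebra_def)
      ultimately have "(LINT x:S|P0. Y x) = 0" if "S \<in> sets B0" for S
        using set_integral_eq_zero_sigma_sets[OF intY stable] that by blast
      \<comment> \<open>Measurability of \<open>Y\<close> with respect to \<open>B0\<close> is what
        makes integrals over sets of \<open>B0\<close> alone determine it.\<close>
      then have "AE x in P0. Y x = 0"
        by (intro P0.AE_eq_zero_if_set_integral_zero[OF P0_B0 intY Y])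
      then show "AE x in P \<theta>. Y x = 0" by (rule AE_P_if_AE_P0[OF \<theta>])
    qed
  qed
qed

end
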